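(* There are digraphs with bar visibility number $3$ whose underlying undirected graph is a bar visibility graph.
   Context: Graphs and digraphs are finite, without loops or multiple edges/arcs. A bar is a horizontal line segment of positive length in the plane; bars do not overlap (bars at the same height may at most share an endpoint). A channel is a vertical strip of positive width. Two bars see each other if there is an unblocked channel between them, i.e. a vertical strip of positive width meeting both bars such that no other bar meets the part of the strip between the two. Directed case: a $t$-bar visibility representation of a digraph $G$ assigns each vertex at most $t$ bars in the plane so that, for distinct vertices $x,y$, there is an arc $xy$ (from $x$ to $y$) in $G$ if and only if some bar for $x$ sees some bar for $y$ above it along an unblocked channel (visibilities between two bars of the same vertex are ignored). The bar visibility number $b(G)$ is the least $t$ such that $G$ has a $t$-bar visibility representation. Undirected case: a graph is a bar visibility graph if each vertex can be assigned one bar in the plane so that two vertices are adjacent if and only if their bars see each other along an unblocked channel. *)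

theory Defs
  imports Complex_Main "Graph_Theory.Graph_Theory"
begin

section \<open>Bars and visibility\<close>

record bar =
  height :: real
  left :: real
  right :: real

definition is_bar :: "bar \<Rightarrow> bool" where
  "is_bar a \<longleftrightarrow> left a < right a"

definition bar_points :: "bar \<Rightarrow> (real \<times> real) set" where
  "bar_points a = {left a..right a} \<times> {height a}"

text \<open>Bars are closed segments, so bars at the same height may share an endpoint.
  A bar overlaps itself.\<close>

definition overlap :: "bar \<Rightarrow> bar \<Rightarrow> bool" where
  "overlap a b \<longleftrightarrow>
     height a = height b \<and> {left a<..<right a} \<inter> {left b<..<right b} \<noteq> {}"

text \<open>\<open>sees_above S a b\<close>: in the configuration \<open>S\<close> of bars, \<open>a\<close> sees \<open>b\<close> above it, along
  the channel \<open>{c..d} \<times> UNIV\<close>. The channel lies within the horizontal extent of both bars. The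
  part of it strictly between the two heights contains no point of \<open>a\<close> or \<open>b\<close>, so these
  need not be excluded from \<open>S\<close>.\<close>

definition sees_above :: "bar set \<Rightarrow> bar \<Rightarrow> bar \<Rightarrow> bool" where
  "sees_above S a b \<longleftrightarrow> height a < height b \<and>
     (\<exists>c d. c < d \<and> {c..d} \<subseteq> {left a..right a} \<and> {c..d} \<subseteq> {left b..right b} \<and>
        (\<forall>e\<in>S. bar_points e \<inter> ({c..d} \<times> {height a<..<height b}) = {}))"

text \<open>An assignment of finitely many bars to each vertex in \<open>V\<close>, no two of which overlap,
  whether they belong to the same vertex or not; in particular no bar is assigned to two
  vertices.\<close>

definition bar_layout :: "'a set \<Rightarrow> ('a \<Rightarrow> bar set) \<Rightarrow> bool" where
  "bar_layout V B \<longleftrightarrow>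
     (\<forall>x\<in>V. finite (B x) \<and> (\<forall>a\<in>B x. is_bar a)) \<and>
     (\<forall>x\<in>V. \<forall>y\<in>V. \<forall>a\<in>B x. \<forall>b\<in>B y. (x, a) \<noteq> (y, b) \<longrightarrow> \<not> overlap a b)"

section \<open>Bar visibility number of a digraph\<close>

definition bar_visibility_rep :: "nat \<Rightarrow> 'a pair_pre_digraph \<Rightarrow> ('a \<Rightarrow> bar set) \<Rightarrow> bool" where
  "bar_visibility_rep t G B \<longleftrightarrow>
     bar_layout (pverts G) B \<and>
     (\<forall>x\<in>pverts G. card (B x) \<le> t) \<and>
     (\<forall>x\<in>pverts G. \<forall>y\<in>pverts G. x \<noteq> y \<longrightarrow>
        ((x, y) \<in> parcs G \<longleftrightarrow>
         (\<exists>a\<in>B x. \<exists>b\<in>B y. sees_above (\<Union>z\<in>pverts G. B z) a b)))"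

text \<open>An equation \<open>bar_visibility_number G = t\<close> is informative only if \<open>G\<close> has some
  representation: the least element of an empty set of naturals is unspecified.\<close>

definition bar_visibility_number :: "'a pair_pre_digraph \<Rightarrow> nat" where
  "bar_visibility_number G = (LEAST t. \<exists>B. bar_visibility_rep t G B)"

section \<open>Bar visibility graphs\<close>

text \<open>Undirected graphs are symmetric digraphs, as in \<^locale>\<open>pair_graph\<close>.\<close>

definition bar_visibility_graph :: "'a pair_pre_digraph \<Rightarrow> bool" where
  "bar_visibility_graph H \<longleftrightarrow> pair_graph H \<and>
     (\<exists>f. bar_layout (pverts H) (\<lambda>x. {f x}) \<and>
        (\<forall>x\<in>pverts H. \<forall>y\<in>pverts H. x \<noteq> y \<longrightarrow>
           ((x, y) \<in> parcs H \<longleftrightarrow>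
            sees_above (f ` pverts H) (f x) (f y) \<or> sees_above (f ` pverts H) (f y) (f x))))"

end

theory Submission
  imports Defs
begin

text \<open>
  If one bar lies below another and their horizontal extents share an interval, then the vertex of
  the upper bar is reachable from that of the lower one, through the bars in between. Take two
  hubs and nine pairs of a source and a sink, with arcs from both hubs and from the source to the
  sink, and suppose that there are only two bars per vertex. Bars of distinct sinks never lie one
  above the other, so the at most eight endpoints of hub bars lie under the interior of bars of
  at most eight sinks. For a remaining sink, a hub bar that it sees spans the whole width of the
  sink's bar. Hence its two bars lie each over a bar of a different hub, and
  a bar of the source, wherever it is seen from the sink, lies above one of the hubs, so that
  the source is reachable from the hub, which is absurd.

  Adding the arcs from the sources to the hubs and an arc between the hubs makes the underlying
  graph a bar visibility graph in which every two bars with overlapping extents see each other.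
\<close>

section \<open>Channels, blocking and overlap\<close>

text \<open>The channel is shrunk to the middle third of \<open>{c..d}\<close>: channels and bars
  are closed, so a bar merely touching the boundary of the strip would otherwise meet it.\<close>

lemma sees_aboveI:
  assumes "height a < height b" "c < d"
    and "left a \<le> c" "d \<le> right a" "left b \<le> c" "d \<le> right b"
    and free: "\<And>e. e \<in> S \<Longrightarrow> height a < height e \<Longrightarrow> height e < height b \<Longrightarrow>
                 right e \<le> c \<or> d \<le> left e"
  shows "sees_above S a b"
  unfolding sees_above_def
proof (intro conjI exI ballI)
  let ?c = "(2 * c + d) / 3" and ?d = "(c + 2 * d) / 3"
  show "height a < height b" by fact
  show "?c < ?d" using assms(2) by simp
  show "{?c..?d} \<subseteq> {left a..right a}" "{?c..?d} \<subseteq> {left b..right b}"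
    using assms(2-6) by auto
  fix e assume "e \<in> S"
  then show "bar_points e \<inter> ({?c..?d} \<times> {height a<..<height b}) = {}"
    using free[of e] assms(2) by (auto simp: bar_points_def)
qed

lemma sees_above_common:
  assumes "sees_above S a b"
  shows "height a < height b" "max (left a) (left b) < min (right a) (right b)"
  using assms by (fastforce simp: sees_above_def)+

text \<open>A bar below \<open>a\<close> that spans its whole width crosses every channel reaching
  \<open>a\<close> from a lower height.\<close>

lemma sees_above_blocked:
  assumes "sees_above S e a" "w \<in> S" "height w < height a"
    and span: "left w \<le> left a" "right a \<le> right w"
  shows "height w \<le> height e"
proof (rule ccontr)
  assume "\<not> height w \<le> height e"
  moreover obtain c d where "c < d" "{c..d} \<subseteq> {left a..right a}"
    "\<forall>w\<in>S. bar_points w \<inter> ({c..d} \<times> {height e<..<height a}) = {}"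
    using assms(1) by (auto simp: sees_above_def)
  moreover from this have "(c, height w) \<in> bar_points w"
    using span by (auto simp: bar_points_def)
  ultimately show False
    using assms(2,3) by fastforce
qed

lemma layout_no_overlap:
  assumes "bar_layout V B" "x \<in> V" "y \<in> V" "a \<in> B x" "b \<in> B y"
    and "max (left a) (left b) < min (right a) (right b)" "height a = height b"
  shows "x = y \<and> a = b"
proof -
  obtain z where "max (left a) (left b) < z" "z < min (right a) (right b)"
    using assms(6) dense by blast
  then have "overlap a b"
    using assms(7) by (auto simp: overlap_def)
  then show ?thesis
    using assms(1-5) unfolding bar_layout_def by blast
qed

section \<open>Visibility and reachability in a representation\<close>

context
  fixes t :: nat and G :: "'a pair_pre_digraph" and B :: "'a \<Rightarrow> bar set"
  assumes rep: "bar_visibility_rep t G B" and fin: "finite (pverts G)"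
begin

lemma rep_layout: "bar_layout (pverts G) B"
  using rep by (simp add: bar_visibility_rep_def)

lemma rep_finite: "finite (\<Union>z\<in>pverts G. B z)"
  using rep_layout fin by (simp add: bar_layout_def)

lemma rep_is_bar: "x \<in> pverts G \<Longrightarrow> a \<in> B x \<Longrightarrow> left a < right a"
  using rep_layout by (auto simp: bar_layout_def is_bar_def)

text \<open>The reflexive closure absorbs visibilities between two bars of one vertex, which
  correspond to no arc.\<close>

lemma rep_sees:
  assumes "x \<in> pverts G" "y \<in> pverts G" "a \<in> B x" "b \<in> B y"
    "sees_above (\<Union>z\<in>pverts G. B z) a b"
  shows "(x, y) \<in> (parcs G)\<^sup>*"
proof (cases "x = y")
  case False
  then have "(x, y) \<in> parcs G"
    using rep assms unfolding bar_visibility_rep_def by blast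
  then show ?thesis by simp
qed simp

lemma rep_arcE:
  assumes "(x, y) \<in> parcs G" "x \<in> pverts G" "y \<in> pverts G" "x \<noteq> y"
  obtains a b where "a \<in> B x" "b \<in> B y" "sees_above (\<Union>z\<in>pverts G. B z) a b"
  using rep assms unfolding bar_visibility_rep_def by blast

lemma rep_reach:
  assumes "x \<in> pverts G" "y \<in> pverts G" "a \<in> B x" "b \<in> B y"
    and "height a < height b" "max (left a) (left b) < min (right a) (right b)"
  shows "(x, y) \<in> (parcs G)\<^sup>*"
proof -
  define S where "S = (\<Union>z\<in>pverts G. B z)"
  \<comment> \<open>Induction on the number of bars at heights strictly between. A bar
    \<open>e\<close> meeting the strip splits the claim into two, on the strip narrowed to the
    extent of \<open>e\<close>; if there is none, \<open>a\<close> sees \<open>b\<close>.\<close>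
  have chain: "(x, y) \<in> (parcs G)\<^sup>*"
    if "x \<in> pverts G" "y \<in> pverts G" "a \<in> B x" "b \<in> B y" "height a < height b"
      "c < d" "left a \<le> c" "d \<le> right a" "left b \<le> c" "d \<le> right b" for x y a b c d
    using that
  proof (induction "card {e \<in> S. height a < height e \<and> height e < height b}"
      arbitrary: x y a b c d rule: less_induct)
    case less
    show ?case
    proof (cases "\<exists>e\<in>S. height a < height e \<and> height e < height b \<and> c < right e \<and> left e < d")
      case True
      then obtain e z where e: "z \<in> pverts G" "e \<in> B z" "e \<in> S" "height a < height e"
          "height e < height b" "c < right e" "left e < d"
        by (auto simp: S_def)
      let ?c = "max c (left e)" and ?d = "min d (right e)"
      have wd: "?c < ?d"
        using e rep_is_bar less.prems(6) by auto
      have S: "finite S"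
        using rep_finite by (simp add: S_def)
      have "(x, z) \<in> (parcs G)\<^sup>*"
      proof (rule less.hyps[where c = ?c and d = ?d])
        show "card {g \<in> S. height a < height g \<and> height g < height e}
            < card {g \<in> S. height a < height g \<and> height g < height b}"
          using e S by (intro psubset_card_mono) auto
      qed (use less.prems e wd in auto)
      moreover have "(z, y) \<in> (parcs G)\<^sup>*"
      proof (rule less.hyps[where c = ?c and d = ?d])
        show "card {g \<in> S. height e < height g \<and> height g < height b}
            < card {g \<in> S. height a < height g \<and> height g < height b}"
          using e S by (intro psubset_card_mono) auto
      qed (use less.prems e wd in auto)
      ultimately show ?thesis by simp
    next
      case False
      then have "sees_above S a b"
        using less.prems by (intro sees_aboveI[of _ _ c d]) force+
      then show ?thesis
        using rep_sees less.prems unfolding S_def by blast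
    qed
  qed
  show ?thesis
    by (rule chain[OF assms(1-6)]) auto
qed

text \<open>The spanning bar \<open>f\<close> blocks everything below it, so \<open>e\<close> is no
  lower than \<open>f\<close>. Equal heights would be an overlap; hence \<open>e\<close> lies above
  \<open>f\<close> over a common interval.\<close>

lemma rep_spanned:
  assumes "x \<in> pverts G" "w \<in> pverts G" "x \<noteq> w" "e \<in> B x" "f \<in> B w"
    and sees: "sees_above (\<Union>z\<in>pverts G. B z) e a"
    and "height f < height a" "left f \<le> left a" "right a \<le> right f"
  shows "height f < height e" "(w, x) \<in> (parcs G)\<^sup>*"
proof -
  have le: "height f \<le> height e"
    using sees_above_blocked[OF sees, of f] assms by blast
  have ov: "max (left f) (left e) < min (right f) (right e)"
    using sees_above_common[OF sees] assms(8,9) by auto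
  show "height f < height e"
    using le layout_no_overlap[OF rep_layout assms(2,1,5,4) ov] assms(3) by fastforce
  then show "(w, x) \<in> (parcs G)\<^sup>*"
    using rep_reach assms(1-5) ov by blast
qed

end

section \<open>Impossibility with two bars per vertex\<close>

lemma rtrancl_sink: "(x, y) \<in> R\<^sup>* \<Longrightarrow> x \<notin> Domain R \<Longrightarrow> x = y"
  by (erule converse_rtranclE) auto

lemma rtrancl_source: "(x, y) \<in> R\<^sup>* \<Longrightarrow> y \<notin> Range R \<Longrightarrow> x = y"
  by (erule rtranclE) auto

lemma no_rep_2:
  fixes G :: "'a pair_pre_digraph" and a b :: "nat \<Rightarrow> 'a"
  assumes rep: "bar_visibility_rep 2 G B" and dig: "pair_digraph G"
    and inj: "inj_on a {..<9}" and uv: "u \<noteq> v"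
    and sink: "\<And>i. i < 9 \<Longrightarrow> a i \<notin> Domain (parcs G)"
    and source: "\<And>i. i < 9 \<Longrightarrow> b i \<notin> Range (parcs G)"
    and arcs: "\<And>i. i < 9 \<Longrightarrow> {(u, a i), (v, a i), (b i, a i)} \<subseteq> parcs G"
    and b: "\<And>i. i < 9 \<Longrightarrow> b i \<noteq> u \<and> b i \<noteq> v"
  shows False
proof -
  interpret pair_digraph G by fact
  note fin = pair_finite_verts
  let ?S = "\<Union>z\<in>pverts G. B z"
  have arc_verts: "x \<in> pverts G \<and> y \<in> pverts G \<and> x \<noteq> y" if "(x, y) \<in> parcs G" for x y
    using in_arcsD1[OF that] in_arcsD2[OF that] pair_no_loops that by fastforce
  have verts: "u \<in> pverts G" "v \<in> pverts G"
    and ab: "\<And>i. i < 9 \<Longrightarrow> a i \<in> pverts G \<and> b i \<in> pverts G"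
    using arcs arc_verts by (meson insert_subset zero_less_numeral)+
  \<comment> \<open>The two hubs have at most four bars, hence at most eight endpoint abscissae, one
    fewer than there are sinks.\<close>
  define P where "P = left ` (B u \<union> B v) \<union> right ` (B u \<union> B v)"
  have finB: "finite (B x)" and cardB: "card (B x) \<le> 2" if "x \<in> pverts G" for x
    using rep that by (auto simp: bar_visibility_rep_def bar_layout_def)
  have "finite (B u \<union> B v)" "card (B u \<union> B v) \<le> 4"
    using finB verts cardB[OF verts(1)] cardB[OF verts(2)] card_Un_le[of "B u" "B v"] by auto
  then have P: "finite P" "card P \<le> 8"
    using card_Un_le[of "left ` (B u \<union> B v)" "right ` (B u \<union> B v)"]
      card_image_le[of "B u \<union> B v" left] card_image_le[of "B u \<union> B v" right]
    by (auto simp: P_def)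

  \<comment> \<open>Otherwise the bars overlap or one sink reaches the other, but a sink reaches
    only itself.\<close>
  have disjoint: "i = j" if "i < 9" "j < 9" "e \<in> B (a i)" "f \<in> B (a j)"
    "left e < p" "p < right e" "left f < p" "p < right f" for i j e f p
  proof -
    have "max (left e) (left f) < min (right e) (right f)"
      "max (left f) (left e) < min (right f) (right e)"
      using that by auto
    then have "a i = a j"
      using that(1-4) ab rep_reach[OF rep fin, of "a i" "a j" e f]
        rep_reach[OF rep fin, of "a j" "a i" f e] sink rtrancl_sink
        layout_no_overlap[OF rep_layout[OF rep fin], of "a i" "a j" e f]
      by (metis linorder_less_linear)
    then show ?thesis
      using inj that(1,2) by (auto dest: inj_onD)
  qed
  \<comment> \<open>otherwise nine sinks would have distinct endpoints of hub bars under them\<close>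
  have "\<exists>i<9. \<forall>e\<in>B (a i). \<forall>p\<in>P. \<not> (left e < p \<and> p < right e)"
  proof (rule ccontr)
    assume "\<not> ?thesis"
    then have "\<forall>i\<in>{..<9}. \<exists>p. p \<in> P \<and> (\<exists>e\<in>B (a i). left e < p \<and> p < right e)"
      by blast
    then obtain p where p: "\<And>i. i < 9 \<Longrightarrow> p i \<in> P"
      "\<And>i. i < 9 \<Longrightarrow> \<exists>e\<in>B (a i). left e < p i \<and> p i < right e"
      by (metis lessThan_iff)
    have "inj_on p {..<9}"
      using p(2) disjoint by (intro inj_onI) (metis lessThan_iff)
    then have "card {..<9::nat} \<le> card P"
      using p(1) P(1) by (intro card_inj_on_le) auto
    with P(2) show False by simp
  qed
  then obtain i where i: "i < 9"
    and clear: "\<And>e p. e \<in> B (a i) \<Longrightarrow> p \<in> P \<Longrightarrow> p \<le> left e \<or> right e \<le> p"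
    by (meson not_less)
  \<comment> \<open>A hub bar sharing an interval with a bar of this sink, and with no endpoint
    strictly inside its extent, covers that extent.\<close>
  have spanned: "\<exists>e f. e \<in> B w \<and> f \<in> B (a i) \<and> sees_above ?S e f \<and>
      height e < height f \<and> left e \<le> left f \<and> right f \<le> right e" if "w \<in> {u, v}" for w
  proof -
    have "(w, a i) \<in> parcs G"
      using that arcs[OF i] by auto
    then obtain e f where ef: "e \<in> B w" "f \<in> B (a i)" "sees_above ?S e f"
      using rep_arcE[OF rep fin] arc_verts by metis
    moreover have "left e \<in> P" "right e \<in> P"
      using that ef by (auto simp: P_def)
    ultimately show ?thesis
      using clear sees_above_common[OF ef(3)] by fastforce
  qed
  obtain e f where u: "e \<in> B u" "f \<in> B (a i)" "sees_above ?S e f"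
      "height e < height f" "left e \<le> left f" "right f \<le> right e"
    using spanned[of u] by auto
  obtain e' f' where v: "e' \<in> B v" "f' \<in> B (a i)" "sees_above ?S e' f'"
      "height e' < height f'" "left e' \<le> left f'" "right f' \<le> right e'"
    using spanned[of v] by auto
  \<comment> \<open>If they were equal, \<open>e\<close> and \<open>e'\<close> would both span this
    bar and see it, so each would lie strictly below the other.\<close>
  have "f \<noteq> f'"
    using rep_spanned(1)[OF rep fin verts(1,2) uv u(1) v(1) u(3)]
      rep_spanned(1)[OF rep fin verts(2,1) uv[symmetric] v(1) u(1) v(3)] u v by fastforce
  then have "card {f, f'} = 2" by simp
  then have Ba: "B (a i) = {f, f'}"
    using card_seteq[of "B (a i)" "{f, f'}"] u(2) v(2) finB cardB ab[OF i] by auto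
  obtain g h where g: "g \<in> B (b i)" "h \<in> B (a i)" "sees_above ?S g h"
    using rep_arcE[OF rep fin, of "b i" "a i"] arcs[OF i] arc_verts by (metis insert_subset)
  have bi: "b i \<in> pverts G" "b i \<noteq> u" "b i \<noteq> v"
    using ab b i by auto
  \<comment> \<open>The bar \<open>h\<close> is \<open>f\<close> or \<open>f'\<close>, so a hub bar
    spans it from below, and \<open>g\<close> must lie above that hub bar.\<close>
  have "(u, b i) \<in> (parcs G)\<^sup>* \<or> (v, b i) \<in> (parcs G)\<^sup>*"
    using g(2) rep_spanned(2)[OF rep fin bi(1) verts(1) bi(2) g(1) u(1) g(3)]
      rep_spanned(2)[OF rep fin bi(1) verts(2) bi(3) g(1) v(1) g(3)] u v
    unfolding Ba by blast
  then show False
    using rtrancl_source source[OF i] bi by metis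
qed

section \<open>The example digraph\<close>

text \<open>Parity separates sinks from sources; starting at 4 leaves 0 and 2 free for the
  hubs.\<close>

definition sink :: "nat \<Rightarrow> nat" where "sink i = 2 * i + 4"

definition source :: "nat \<Rightarrow> nat" where "source i = 2 * i + 1"

lemma sink_source_eq [simp]:
  "sink i = sink j \<longleftrightarrow> i = j" "source i = source j \<longleftrightarrow> i = j"
  "sink i \<noteq> source j" "source i \<noteq> sink j"
  "sink i \<noteq> 0" "sink i \<noteq> 2" "source i \<noteq> 0" "source i \<noteq> 2"
  "0 \<noteq> sink i" "2 \<noteq> sink i" "0 \<noteq> source i" "2 \<noteq> source i"
  unfolding sink_def source_def by presburger+

text \<open>The hubs are 0 and 2; neither is 1, which the simplifier would rewrite to \<open>Suc 0\<close>.\<close>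

definition example :: "nat pair_pre_digraph" where
  "example = \<lparr>pverts = {0, 2} \<union> sink ` {..<9} \<union> source ` {..<9},
     parcs = insert (0, 2) (\<Union>i<9.
       {(0, sink i), (2, sink i), (source i, 0), (source i, 2), (source i, sink i)})\<rparr>"

lemma example_vertsE:
  assumes "x \<in> pverts example"
  obtains "x = 0" | "x = 2" | i where "i < 9" "x = sink i" | i where "i < 9" "x = source i"
  using assms by (auto simp: example_def)

lemma example_digraph: "pair_digraph example"
  by unfold_locales (auto simp: example_def)

section \<open>A representation with three bars per vertex\<close>

lemma overlap_iff:
  "overlap a b \<longleftrightarrow> height a = height b \<and> max (left a) (left b) < min (right a) (right b)"
proof -
  have "{left a<..<right a} \<inter> {left b<..<right b} =
      {max (left a) (left b)<..<min (right a) (right b)}"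
    by auto
  then show ?thesis
    by (simp only: overlap_def greaterThanLessThan_empty_iff not_le)
qed

text \<open>Four separate blocks realise the arcs. Over [0, 9] hub 0 lies between sources and sinks,
  over [10, 19] hub 2 does, over [20, 29] each source lies directly under its sink, and over
  [30, 31] hub 0 lies under hub 2.\<close>

definition triple_bars :: "nat \<Rightarrow> bar set" where
  "triple_bars x =
    (if x = 0 then {\<lparr>height = 1, left = 0, right = 9\<rparr>, \<lparr>height = 0, left = 30, right = 31\<rparr>}
     else if x = 2 then {\<lparr>height = 1, left = 10, right = 19\<rparr>, \<lparr>height = 1, left = 30, right = 31\<rparr>}
     else if even x then let i = real (x div 2 - 2) in
       {\<lparr>height = 2, left = i, right = i + 1\<rparr>, \<lparr>height = 2, left = 10 + i, right = 11 + i\<rparr>,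
        \<lparr>height = 1, left = 20 + i, right = 21 + i\<rparr>}
     else let i = real (x div 2) in
       {\<lparr>height = 0, left = i, right = i + 1\<rparr>, \<lparr>height = 0, left = 10 + i, right = 11 + i\<rparr>,
        \<lparr>height = 0, left = 20 + i, right = 21 + i\<rparr>})"

lemma triple_bars_simps:
  "triple_bars 0 = {\<lparr>height = 1, left = 0, right = 9\<rparr>, \<lparr>height = 0, left = 30, right = 31\<rparr>}"
  "triple_bars 2 = {\<lparr>height = 1, left = 10, right = 19\<rparr>, \<lparr>height = 1, left = 30, right = 31\<rparr>}"
  "triple_bars (sink i) =
     {\<lparr>height = 2, left = i, right = i + 1\<rparr>, \<lparr>height = 2, left = 10 + i, right = 11 + i\<rparr>,
      \<lparr>height = 1, left = 20 + i, right = 21 + i\<rparr>}"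
  "triple_bars (source i) =
     {\<lparr>height = 0, left = i, right = i + 1\<rparr>, \<lparr>height = 0, left = 10 + i, right = 11 + i\<rparr>,
      \<lparr>height = 0, left = 20 + i, right = 21 + i\<rparr>}"
  by (auto simp: triple_bars_def sink_def source_def Let_def)

text \<open>A case check over the kinds of vertices, which yields both that no bars overlap and that
  every visibility is an arc.\<close>

lemma triple_bars_common:
  assumes "x \<in> pverts example" "y \<in> pverts example" "a \<in> triple_bars x" "b \<in> triple_bars y"
    and "max (left a) (left b) < min (right a) (right b)" "height a \<le> height b"
  shows "x = y \<and> a = b \<or> height a < height b \<and> (x, y) \<in> parcs example"
proof -
  have less_9: "i < 9 \<Longrightarrow> real i \<le> 8" for i by simp
  show ?thesis
    by (rule example_vertsE[OF assms(1)]; rule example_vertsE[OF assms(2)])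
      (use assms(3-6) in \<open>auto simp: triple_bars_simps example_def dest: less_9\<close>)
qed

lemma triple_rep: "bar_visibility_rep 3 example triple_bars"
  unfolding bar_visibility_rep_def
proof (intro conjI ballI impI)
  let ?S = "\<Union>z\<in>pverts example. triple_bars z"
  show "bar_layout (pverts example) triple_bars"
    unfolding bar_layout_def
  proof (intro conjI ballI impI)
    fix x assume x: "x \<in> pverts example"
    then show "finite (triple_bars x)"
      by (cases rule: example_vertsE) (auto simp: triple_bars_simps)
    show "is_bar a" if "a \<in> triple_bars x" for a
      using x that by (cases rule: example_vertsE) (auto simp: triple_bars_simps is_bar_def)
  next
    fix x y a b assume "x \<in> pverts example" "y \<in> pverts example"
      "a \<in> triple_bars x" "b \<in> triple_bars y" "(x, a) \<noteq> (y, b)"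
    then show "\<not> overlap a b"
      using triple_bars_common[of x y a b] by (auto simp: overlap_iff)
  qed
  show "card (triple_bars x) \<le> 3" if "x \<in> pverts example" for x
    using that by (cases rule: example_vertsE) (auto simp: triple_bars_simps card_insert_if)
  fix x y assume xy: "x \<in> pverts example" "y \<in> pverts example" "x \<noteq> y"
  show "(x, y) \<in> parcs example \<longleftrightarrow>
      (\<exists>a\<in>triple_bars x. \<exists>b\<in>triple_bars y. sees_above ?S a b)"
  proof
    assume "\<exists>a\<in>triple_bars x. \<exists>b\<in>triple_bars y. sees_above ?S a b"
    then show "(x, y) \<in> parcs example"
      using xy triple_bars_common sees_above_common less_imp_le by metis
  next
    have heights: "height e \<in> {0, 1, 2}" if "e \<in> ?S" for e
      using that by (auto elim!: example_vertsE simp: triple_bars_simps)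
    \<comment> \<open>All heights are 0, 1 or 2, so nothing can block two bars on consecutive
      levels.\<close>
    have sees: "sees_above ?S a b"
      if "height b = height a + 1" "height a \<in> {0, 1}" "max (left a) (left b) < min (right a) (right b)" for a b
    proof (rule sees_aboveI[OF _ that(3)])
      show "right e \<le> max (left a) (left b) \<or> min (right a) (right b) \<le> left e"
        if "e \<in> ?S" "height a < height e" "height e < height b" for e
        using heights that \<open>height b = height a + 1\<close> \<open>height a \<in> {0, 1}\<close> by fastforce
    qed (use that in auto)
    assume "(x, y) \<in> parcs example"
    then have "\<exists>a\<in>triple_bars x. \<exists>b\<in>triple_bars y. height b = height a + 1 \<and>
        height a \<in> {0, 1} \<and> max (left a) (left b) < min (right a) (right b)"
      by (auto simp: example_def triple_bars_simps)
    then show "\<exists>a\<in>triple_bars x. \<exists>b\<in>triple_bars y. sees_above ?S a b"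
      using sees by blast
  qed
qed

section \<open>A bar layout of the underlying graph\<close>

text \<open>The hub bars protrude to the left of 0, where they see each other.\<close>

definition single_bar :: "nat \<Rightarrow> bar" where
  "single_bar x =
    (if x = 0 then \<lparr>height = 0, left = -1, right = 27\<rparr>
     else if x = 2 then \<lparr>height = 3, left = -1, right = 27\<rparr>
     else if even x then let i = real (x div 2 - 2) in \<lparr>height = 1, left = 3 * i, right = 3 * i + 2\<rparr>
     else let i = real (x div 2) in \<lparr>height = 2, left = 3 * i + 1, right = 3 * i + 3\<rparr>)"

lemma single_bar_simps:
  "single_bar 0 = \<lparr>height = 0, left = -1, right = 27\<rparr>"
  "single_bar 2 = \<lparr>height = 3, left = -1, right = 27\<rparr>"
  "single_bar (sink i) = \<lparr>height = 1, left = 3 * i, right = 3 * i + 2\<rparr>"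
  "single_bar (source i) = \<lparr>height = 2, left = 3 * i + 1, right = 3 * i + 3\<rparr>"
  by (auto simp: single_bar_def sink_def source_def Let_def)

text \<open>The hubs are joined to all other vertices, so only sinks and sources matter. Those with
  index \<open>i\<close> stay in the column from \<open>3 * i\<close> to \<open>3 * i + 3\<close>,
  and distinct columns share no interval.\<close>

lemma single_bar_common:
  assumes "x \<in> pverts example" "y \<in> pverts example"
    and "max (left (single_bar x)) (left (single_bar y)) <
      min (right (single_bar x)) (right (single_bar y))"
  shows "x = y \<or> height (single_bar x) \<noteq> height (single_bar y) \<and>
    ((x, y) \<in> parcs example \<or> (y, x) \<in> parcs example)"
proof -
  have column: "i = j"
    if "3 * real i < 3 * real j + 3" "3 * real j < 3 * real i + 3" for i j
    using that by linarith
  show ?thesis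
    by (rule example_vertsE[OF assms(1)]; rule example_vertsE[OF assms(2)])
      (use assms(3) in \<open>auto simp: single_bar_simps example_def intro!: column\<close>)
qed

text \<open>The bars in a column are staggered: its left third leaves the sink open to the upper
  hub, its right third leaves the source open to the lower hub, and in the middle third the sink
  sees the source.\<close>

lemma single_bar_sees:
  assumes "(x, y) \<in> parcs example"
  shows "sees_above (single_bar ` pverts example) (single_bar x) (single_bar y) \<or>
    sees_above (single_bar ` pverts example) (single_bar y) (single_bar x)"
proof -
  let ?S = "single_bar ` pverts example"
  \<comment> \<open>The two conditions over all \<open>i\<close> keep the sinks, at height 1, and
    the sources, at height 2, out of the channel. The hubs, at heights 0 and 3, never lie strictly
    between.\<close>
  have sees: "sees_above ?S (single_bar x) (single_bar y)"
    if "height (single_bar x) < height (single_bar y)" "c < d"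
      "left (single_bar x) \<le> c" "d \<le> right (single_bar x)"
      "left (single_bar y) \<le> c" "d \<le> right (single_bar y)"
      "\<And>i. i < 9 \<Longrightarrow> height (single_bar x) < 1 \<Longrightarrow> 1 < height (single_bar y) \<Longrightarrow>
         3 * real i + 2 \<le> c \<or> d \<le> 3 * real i"
      "\<And>i. i < 9 \<Longrightarrow> height (single_bar x) < 2 \<Longrightarrow> 2 < height (single_bar y) \<Longrightarrow>
         3 * real i + 3 \<le> c \<or> d \<le> 3 * real i + 1"
      "0 \<le> height (single_bar x)" "height (single_bar y) \<le> 3"
    for x y c d
  proof (rule sees_aboveI[OF that(1-6)])
    fix e assume "e \<in> ?S" "height (single_bar x) < height e" "height e < height (single_bar y)"
    then show "right e \<le> c \<or> d \<le> left e"
      using that(7,8) \<open>0 \<le> height (single_bar x)\<close> \<open>height (single_bar y) \<le> 3\<close>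
      by (elim imageE example_vertsE) (simp_all add: single_bar_simps add.commute)
  qed
  \<comment> \<open>No sink bar enters the interior of the right third of column \<open>i\<close>;
    by \<open>column'\<close>, no source bar enters that of its left third.\<close>
  have column: "3 * real k + 2 \<le> 3 * real i + 2 \<or> 3 * real i + 3 \<le> 3 * real k" for i k
    by (cases "k \<le> i") auto
  have column': "3 * real k + 3 \<le> 3 * real i \<or> 3 * real i + 1 \<le> 3 * real k + 1" for i k
    by (cases "i \<le> k") auto
  have "sees_above ?S (single_bar 0) (single_bar 2)"
    by (rule sees[of _ _ "-1" 0]) (auto simp: single_bar_simps)
  moreover have "sees_above ?S (single_bar 0) (single_bar (sink i))"
      "sees_above ?S (single_bar (source i)) (single_bar 2)"
      "sees_above ?S (single_bar (sink i)) (single_bar (source i))"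
      "sees_above ?S (single_bar 0) (single_bar (source i))"
      "sees_above ?S (single_bar (sink i)) (single_bar 2)" if "i < 9" for i
  proof -
    have i: "real i \<le> 8" using that by simp
    show "sees_above ?S (single_bar 0) (single_bar (sink i))"
      using i by (intro sees[of _ _ "3 * i" "3 * i + 2"]) (auto simp: single_bar_simps)
    show "sees_above ?S (single_bar (source i)) (single_bar 2)"
      using i by (intro sees[of _ _ "3 * i + 1" "3 * i + 3"]) (auto simp: single_bar_simps)
    show "sees_above ?S (single_bar (sink i)) (single_bar (source i))"
      using i by (intro sees[of _ _ "3 * i + 1" "3 * i + 2"]) (auto simp: single_bar_simps)
    show "sees_above ?S (single_bar 0) (single_bar (source i))"
      using i column by (intro sees[of _ _ "3 * i + 2" "3 * i + 3"]) (auto simp: single_bar_simps)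
    show "sees_above ?S (single_bar (sink i)) (single_bar 2)"
      using i column' by (intro sees[of _ _ "3 * i" "3 * i + 1"]) (auto simp: single_bar_simps)
  qed
  ultimately show ?thesis
    using assms by (auto simp: example_def)
qed

lemma bar_visibility_graph_example: "bar_visibility_graph (mk_symmetric example)"
proof -
  interpret pair_digraph example by (rule example_digraph)
  have arcs: "(x, y) \<in> parcs (mk_symmetric example) \<longleftrightarrow>
      (x, y) \<in> parcs example \<or> (y, x) \<in> parcs example" for x y
    unfolding parcs_mk_symmetric by (auto intro: bexI[of _ "(y, x)"])
  interpret H: pair_digraph "mk_symmetric example"
    by (rule digraph_mk_symmetric)
  have "pair_graph (mk_symmetric example)"
    by unfold_locales (rule symmetric_mk_symmetric)
  moreover have "bar_layout (pverts example) (\<lambda>x. {single_bar x})"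
    unfolding bar_layout_def
  proof (intro conjI ballI impI)
    show "is_bar a" if "x \<in> pverts example" "a \<in> {single_bar x}" for x a
      using that by (cases rule: example_vertsE) (auto simp: single_bar_simps is_bar_def)
    show "\<not> overlap a b" if "x \<in> pverts example" "y \<in> pverts example"
      "a \<in> {single_bar x}" "b \<in> {single_bar y}" "(x, a) \<noteq> (y, b)" for x y a b
      using that single_bar_common[of x y] by (auto simp: overlap_iff)
  qed simp
  moreover have "(x, y) \<in> parcs example \<or> (y, x) \<in> parcs example \<longleftrightarrow>
      sees_above (single_bar ` pverts example) (single_bar x) (single_bar y) \<or>
      sees_above (single_bar ` pverts example) (single_bar y) (single_bar x)"
    if "x \<in> pverts example" "y \<in> pverts example" "x \<noteq> y" for x y
    using that single_bar_sees single_bar_common sees_above_common(2) by metis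
  ultimately show ?thesis
    unfolding bar_visibility_graph_def by (auto simp: arcs intro!: exI[of _ single_bar])
qed

section \<open>The bar visibility number of the example\<close>

lemma example_no_rep_2: "\<not> bar_visibility_rep 2 example B"
proof
  assume "bar_visibility_rep 2 example B"
  then show False
    by (rule no_rep_2[OF _ example_digraph, where a = sink and b = source and u = 0 and v = 2])
      (auto simp: example_def inj_on_def)
qed

theorem theorem4p4:
  shows "\<exists>G :: nat pair_pre_digraph. pair_digraph G \<and>
           (\<exists>B. bar_visibility_rep 3 G B) \<and>
           bar_visibility_number G = 3 \<and>
           bar_visibility_graph (mk_symmetric G)"
proof -
  have "3 \<le> t" if "bar_visibility_rep t example B" for t B
  proof (rule ccontr)
    assume "\<not> 3 \<le> t"
    then have "bar_visibility_rep 2 example B"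
      using that by (fastforce simp: bar_visibility_rep_def)
    then show False
      using example_no_rep_2 by blast
  qed
  then have "bar_visibility_number example = 3"
    unfolding bar_visibility_number_def using triple_rep by (intro Least_equality) auto
  then show ?thesis
    using example_digraph triple_rep bar_visibility_graph_example by blast
qed

end
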